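(* Let $J\in\mathbb{N}$, $\mathcal{X} = \{-J,-J+1,\ldots,J-1,J\}$, and let $H(x)=-|x|$ for $x<J-1$, $H(J-1)=-J$, $H(J)=-J-1$. Let $N$ be the simple nearest-neighbour random walk on $\mathcal{X}$ with holding probability $1/2$ at the two endpoints $\pm J$. For inverse temperature $\beta\ge0$ let $P_\beta$ be the Metropolis-Hastings transition matrix with proposal $N$ targeting $\pi_\beta(x)\propto e^{-\beta H(x)}$. Let $Q=Q_\psi$ be the permutation matrix of the map $\psi$ with $\psi(-J)=J-1$, $\psi(J-1)=-J$ and $\psi(x)=x$ for all other $x$, and let $\overline{(P_\beta)}_{1/2}(Q):=\frac12(P_\beta+QP_\beta Q)$. Then $$ \lim_{\beta \to \infty} \frac{1}{\beta} \ln \big(t_{rel}(\overline{(P_\beta)}_{1/2}(Q))\big) = 0, \qquad \lim_{\beta \to \infty} \frac{1}{\beta} \ln \big(t_{rel}(P_\beta)\big) = J. $$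
   Context: $N(x,x\pm1)=1/2$ whenever $x\pm1\in\mathcal{X}$, and $N(J,J)=N(-J,-J)=1/2$. The Metropolis-Hastings matrix is $P_\beta(x,y)=N(x,y)e^{-\beta(H(y)-H(x))_+}$ for $x\ne y$, with $P_\beta(x,x)=1-\sum_{z\ne x}P_\beta(x,z)$. The permutation matrix is $Q_\psi(x,y)=\delta_{y=\psi(x)}$. For a reversible transition matrix $P$ with eigenvalues $1=\lambda_1(P)\ge\lambda_2(P)\ge\cdots$, the relaxation time is $t_{rel}(P):=1/(1-\lambda_2(P))$.
   Formalization: J is taken to be at least 1 (for J = 0 the state J−1 and λ_2 do not exist), and the second limit is claimed only for J ≥ 2: for J = 1 there is no energy barrier, λ_2(P_β) tends to (1+√5)/4, so t_rel(P_β) stays bounded and the limit is 0, not 1. *)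

theory Defs
  imports Complex_Main "Jordan_Normal_Form.Char_Poly"
begin

section \<open>Metropolis--Hastings chains and relaxation times\<close>

text \<open>
  A kernel on a finite set \<open>X\<close> of integers is a function \<open>int \<Rightarrow> int \<Rightarrow> real\<close>, of which only the
  values on \<open>X \<times> X\<close> matter. The off-diagonal formula uses a proposal kernel \<open>N\<close> that is symmetric.
\<close>

definition metropolis ::
  "int set \<Rightarrow> (int \<Rightarrow> int \<Rightarrow> real) \<Rightarrow> (int \<Rightarrow> real) \<Rightarrow> real \<Rightarrow> int \<Rightarrow> int \<Rightarrow> real" where
  "metropolis X N H \<beta> x y =
     (if x \<noteq> y then N x y * exp (- \<beta> * max 0 (H y - H x))
      else 1 - (\<Sum>z\<in>X - {x}. N x z * exp (- \<beta> * max 0 (H z - H x))))"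

definition gibbs :: "int set \<Rightarrow> (int \<Rightarrow> real) \<Rightarrow> real \<Rightarrow> int \<Rightarrow> real" where
  "gibbs X H \<beta> x = exp (- \<beta> * H x) / (\<Sum>z\<in>X. exp (- \<beta> * H z))"

lemma metropolis_detailed_balance:
  assumes "\<And>x y. N x y = N y x"
  shows "gibbs X H \<beta> x * metropolis X N H \<beta> x y = gibbs X H \<beta> y * metropolis X N H \<beta> y x"
proof -
  have "exp (- \<beta> * H x) * exp (- \<beta> * max 0 (H y - H x)) =
        exp (- \<beta> * H y) * exp (- \<beta> * max 0 (H x - H y))"
    unfolding exp_add [symmetric] by (auto simp: max_def algebra_simps)
  then show ?thesis
    by (cases "x = y") (simp_all add: metropolis_def gibbs_def assms [of x y] field_simps)
qed

lemma metropolis_row_sum: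
  assumes "finite X" "x \<in> X"
  shows "(\<Sum>y\<in>X. metropolis X N H \<beta> x y) = 1"
  using assms by (simp add: sum.remove [of X x] metropolis_def)

text \<open>
  The real eigenvalues of a matrix, each repeated according to its algebraic multiplicity, in
  decreasing order. A reversible transition matrix has only real eigenvalues, so for such a matrix
  \<open>A\<close> of dimension \<open>n\<close> this is the complete list
  \<open>\<lambda>\<^sub>1(A) \<ge> \<dots> \<ge> \<lambda>\<^sub>n(A)\<close>; list positions start at \<open>0\<close>, so \<open>\<lambda>\<^sub>k(A)\<close> is entry \<open>k - 1\<close>.
\<close>

definition eigenvalues_desc :: "real mat \<Rightarrow> real list" where
  "eigenvalues_desc A = rev (sorted_list_of_multiset (proots (char_poly A)))"

definition eigval :: "nat \<Rightarrow> real mat \<Rightarrow> real" where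
  "eigval k A = eigenvalues_desc A ! (k - 1)"

definition t_rel :: "real mat \<Rightarrow> real" where
  "t_rel A = 1 / (1 - eigval 2 A)"

definition half_mixture :: "real mat \<Rightarrow> real mat \<Rightarrow> real mat" where
  "half_mixture P Q = (1 / 2) \<cdot>\<^sub>m (P + Q * P * Q)"


section \<open>The energy landscape on \<open>{-J, \<dots>, J}\<close>\<close>

definition state_space :: "nat \<Rightarrow> int set" where
  "state_space J = {- int J..int J}"

text \<open>Row or column \<open>i\<close> of a matrix of dimension \<open>2 J + 1\<close> belongs to the state \<open>i - J\<close>.\<close>

definition kernel_mat :: "nat \<Rightarrow> (int \<Rightarrow> int \<Rightarrow> real) \<Rightarrow> real mat" where
  "kernel_mat J K = mat (2 * J + 1) (2 * J + 1) (\<lambda>(i, j). K (int i - int J) (int j - int J))"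

definition nn_walk :: "nat \<Rightarrow> int \<Rightarrow> int \<Rightarrow> real" where
  "nn_walk J x y =
     (if x \<in> state_space J \<and> y \<in> state_space J \<and>
         (y = x + 1 \<or> y = x - 1 \<or> x = int J \<and> y = int J \<or> x = - int J \<and> y = - int J)
      then 1 / 2 else 0)"

definition energy :: "nat \<Rightarrow> int \<Rightarrow> real" where
  "energy J x =
     (if x = int J then - real J - 1
      else if x = int J - 1 then - real J
      else - \<bar>real_of_int x\<bar>)"

definition psi :: "nat \<Rightarrow> int \<Rightarrow> int" where
  "psi J x = (if x = - int J then int J - 1 else if x = int J - 1 then - int J else x)"

definition P_mat :: "nat \<Rightarrow> real \<Rightarrow> real mat" where
  "P_mat J \<beta> = kernel_mat J (metropolis (state_space J) (nn_walk J) (energy J) \<beta>)"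

definition Q_mat :: "nat \<Rightarrow> real mat" where
  "Q_mat J = kernel_mat J (\<lambda>x y. if y = psi J x then 1 else 0)"

lemma nn_walk_sym: "nn_walk J x y = nn_walk J y x"
  by (auto simp: nn_walk_def)

text \<open>
  Since \<open>psi\<close> preserves the energy, \<open>Q P Q\<close>, and hence the mixture, is reversible with respect to
  the same Gibbs measure as \<open>P\<close>.
\<close>

lemma energy_psi: "J \<ge> 1 \<Longrightarrow> energy J (psi J x) = energy J x"
  by (auto simp: energy_def psi_def)

end

theory Submission
  imports Defs "Jordan_Normal_Form.Schur_Decomposition"
begin

text \<open>
  With the unnormalised weights \<open>W x = exp (- \<beta> H x)\<close>, the second eigenvalue of a reversible chain is
  controlled from both sides by comparing the Dirichlet form with \<open>\<Sum> W f\<^sup>2\<close>: from above on the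
  hyperplane \<open>f r = 0\<close> for any state \<open>r\<close>, from below on any two-dimensional space of functions.
  Take \<open>r = J\<close>. In the mixture every state reaches \<open>J\<close> by a path that never climbs: a state
  \<open>x < 0\<close> walks down to \<open>- J\<close>, whence the swapped chain jumps to \<open>J\<close>. Hence the gap is bounded
  below uniformly in \<open>\<beta>\<close>. For \<open>P\<close> itself and \<open>J \<ge> 2\<close>, all edges have conductance at least \<open>1/2\<close> while
  \<open>W \<le> exp (\<beta> J)\<close> off \<open>J\<close>, and the indicator of the negative states crosses only the edge at the
  barrier top \<open>0\<close>; so the gap is \<open>exp (- \<beta> J)\<close> up to a constant.
\<close>

section \<open>Spectral theory of reversible matrices\<close>

lemma proots_linear_prod: "proots (\<Prod>a\<leftarrow>as. [:- a, 1:]) = mset (as :: 'a :: idom list)"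
proof (induction as)
  case (Cons a as)
  have "(\<Prod>a\<leftarrow>as. [:- a, 1:]) \<noteq> 0"
    by (auto simp: prod_list_zero_iff)
  with Cons show ?case
    by (simp add: proots_mult del: mult_pCons_left)
qed simp

text \<open>Detailed balance says that \<open>A\<close> is self-adjoint for the inner product
  weighted by \<open>w\<close>. The spectral theory rests on this and on the positivity of
  \<open>w\<close>; unit row sums enter only in \<open>dform_dirichlet\<close>.\<close>

locale reversible_mat =
  fixes n :: nat and A :: "real mat" and w :: "nat \<Rightarrow> real"
  assumes carrier: "A \<in> carrier_mat n n"
    and w_pos: "i < n \<Longrightarrow> w i > 0"
    and balance: "i < n \<Longrightarrow> j < n \<Longrightarrow> w i * A $$ (i, j) = w j * A $$ (j, i)"
begin

section \<open>Weighted inner product and self-adjointness\<close>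

definition ip :: "(nat \<Rightarrow> real) \<Rightarrow> (nat \<Rightarrow> real) \<Rightarrow> real" where
  "ip f g = (\<Sum>k<n. w k * f k * g k)"

definition app :: "(nat \<Rightarrow> real) \<Rightarrow> nat \<Rightarrow> real" where
  "app f i = (\<Sum>k<n. A $$ (i, k) * f k)"

text \<open>The quadratic form of \<open>1 - A\<close>. For unit row sums it is the usual Dirichlet
  form, by \<open>dform_dirichlet\<close>.\<close>

definition dform :: "(nat \<Rightarrow> real) \<Rightarrow> real" where
  "dform f = ip f f - ip f (app f)"

lemma ip_commute: "ip f g = ip g f"
  by (simp add: ip_def mult_ac)

lemma ip_cong: "(\<And>k. k < n \<Longrightarrow> f k = f' k) \<Longrightarrow> (\<And>k. k < n \<Longrightarrow> g k = g' k) \<Longrightarrow> ip f g = ip f' g'"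
  by (simp add: ip_def)

lemma ip_diff_left: "ip (\<lambda>k. f k - g k) h = ip f h - ip g h"
  by (simp add: ip_def algebra_simps sum_subtractf)

lemma ip_add_left: "ip (\<lambda>k. f k + g k) h = ip f h + ip g h"
  by (simp add: ip_def algebra_simps sum.distrib)

lemma ip_scale_left: "ip (\<lambda>k. c * f k) h = c * ip f h"
  by (simp add: ip_def sum_distrib_left mult_ac)

lemma ip_scale_right: "ip f (\<lambda>k. c * g k) = c * ip f g"
  by (simp add: ip_def sum_distrib_left mult_ac)

lemma ip_sum_left: "ip (\<lambda>k. \<Sum>j\<in>S. f j k) h = (\<Sum>j\<in>S. ip (f j) h)"
  unfolding ip_def by (simp add: sum_distrib_left sum_distrib_right) (rule sum.swap)

lemma ip_nonneg: "ip f f \<ge> 0"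
  unfolding ip_def by (intro sum_nonneg) (simp add: w_pos less_imp_le mult.assoc)

lemma ip_eq_0: 
  assumes "ip f f = 0" "k < n"
  shows "f k = 0"
proof -
  have "\<forall>k\<in>{..<n}. w k * f k * f k = 0"
    using assms(1) unfolding ip_def
    by (subst (asm) sum_nonneg_eq_0_iff) (auto simp: w_pos less_imp_le mult.assoc)
  then show ?thesis using w_pos [OF assms(2)] assms(2) by force
qed

lemma app_sym: "ip (app f) g = ip f (app g)"
proof -
  have "ip (app f) g = (\<Sum>i<n. \<Sum>k<n. w i * A $$ (i, k) * f k * g i)"
    by (simp add: ip_def app_def sum_distrib_left sum_distrib_right mult_ac)
  also have "\<dots> = (\<Sum>i<n. \<Sum>k<n. w k * A $$ (k, i) * f k * g i)"
    by (intro sum.cong refl) (simp add: balance)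
  also have "\<dots> = (\<Sum>k<n. \<Sum>i<n. w k * A $$ (k, i) * f k * g i)"
    by (rule sum.swap)
  also have "\<dots> = ip f (app g)"
    by (simp add: ip_def app_def sum_distrib_left sum_distrib_right mult_ac)
  finally show ?thesis .
qed

lemma app_diff: "app (\<lambda>k. f k - g k) i = app f i - app g i"
  by (simp add: app_def algebra_simps sum_subtractf)

lemma app_scale: "app (\<lambda>k. c * f k) i = c * app f i"
  by (simp add: app_def sum_distrib_left mult_ac)

lemma app_sum: "app (\<lambda>k. \<Sum>j\<in>S. f j k) i = (\<Sum>j\<in>S. app (f j) i)"
  unfolding app_def by (simp add: sum_distrib_left) (rule sum.swap)

section \<open>Real spectrum and the ordered list of eigenvalues\<close>

lemma complex_eigenvalue_real:
  assumes "eigenvalue (map_mat complex_of_real A) e"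
  shows "e \<in> \<real>"
proof -
  let ?A = "map_mat complex_of_real A"
  obtain v where v: "v \<in> carrier_vec n" "v \<noteq> 0\<^sub>v n" "?A *\<^sub>v v = e \<cdot>\<^sub>v v"
    using assms carrier unfolding eigenvalue_def eigenvector_def by auto
  define c where "c k = v $ k" for k
  have ev: "(\<Sum>k<n. of_real (A $$ (i, k)) * c k) = e * c i" if "i < n" for i
    using arg_cong [OF v(3), of "\<lambda>x. x $ i"] that v(1) carrier
    by (simp add: scalar_prod_def c_def lessThan_atLeast0)
  define q where "q = (\<Sum>i<n. w i * (cmod (c i))\<^sup>2)"
  obtain m where m: "m < n" "c m \<noteq> 0"
    using v(1,2) unfolding c_def by (metis carrier_vecD eq_vecI index_zero_vec)
  have "q > 0"
    unfolding q_def using m by (intro sum_pos2 [of _ m]) (auto simp: w_pos less_imp_le)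
  have q: "of_real q = (\<Sum>i<n. of_real (w i) * c i * cnj (c i))"
    by (simp only: q_def of_real_sum of_real_mult complex_norm_square mult.assoc)
  \<comment> \<open>This is the weighted Hermitian form of \<open>A\<close> at the eigenvector
    \<open>c\<close>. The eigenvalue equation gives it the value \<open>e * q\<close> with
    \<open>q > 0\<close>, and detailed balance makes it equal to its own conjugate, so
    \<open>e\<close> is real.\<close>
  let ?B = "\<Sum>i<n. \<Sum>k<n. of_real (w i * A $$ (i, k)) * c k * cnj (c i)"
  have B: "?B = e * of_real q"
  proof -
    have "?B = (\<Sum>i<n. of_real (w i) * cnj (c i) * (\<Sum>k<n. of_real (A $$ (i, k)) * c k))"
      by (simp add: sum_distrib_left mult_ac)
    also have "\<dots> = e * of_real q"
    proof -
      have "\<dots> = (\<Sum>i<n. of_real (w i) * cnj (c i) * (e * c i))"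
        by (intro sum.cong refl) (simp only: ev lessThan_iff)
      then show ?thesis by (simp add: q sum_distrib_left mult_ac)
    qed
    finally show ?thesis .
  qed
  have "cnj ?B = (\<Sum>i<n. \<Sum>k<n. of_real (w i * A $$ (i, k)) * c i * cnj (c k))"
    by (simp add: mult_ac)
  also have "\<dots> = (\<Sum>k<n. \<Sum>i<n. of_real (w i * A $$ (i, k)) * c i * cnj (c k))"
    by (rule sum.swap)
  also have "\<dots> = ?B"
    by (intro sum.cong refl) (simp add: balance)
  finally have "cnj e * of_real q = e * of_real q"
    unfolding B by simp
  with \<open>q > 0\<close> show ?thesis
    by (simp add: Reals_cnj_iff)
qed

text \<open>The polynomial splits over the complex numbers, its roots are real by
  \<open>complex_eigenvalue_real\<close>, and the embedding of real into complex polynomials is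
  injective, so the factorisation descends.\<close>

lemma char_poly_splits: "\<exists>as. char_poly A = (\<Prod>a\<leftarrow>as. [:- a, 1:]) \<and> length as = n"
proof -
  let ?A = "map_mat complex_of_real A"
  interpret map_poly_hom: map_poly_inj_idom_hom complex_of_real ..
  have cA: "?A \<in> carrier_mat n n" using carrier by simp
  obtain cs where cs: "char_poly ?A = (\<Prod>a\<leftarrow>cs. [:- a, 1:])" "length cs = n"
    using char_poly_factorized [OF cA] by blast
  have real: "c \<in> \<real>" if "c \<in> set cs" for c
  proof (rule complex_eigenvalue_real)
    show "eigenvalue ?A c"
      unfolding eigenvalue_root_char_poly [OF cA] cs(1) using that
      by (auto simp: poly_prod_list prod_list_zero_iff o_def)
  qed
  have "map_poly complex_of_real (char_poly A) = (\<Prod>a\<leftarrow>map Re cs. [:- complex_of_real a, 1:])"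
    unfolding of_real_hom.char_poly_hom [OF carrier, symmetric] cs(1) map_map
    by (intro arg_cong [of _ _ prod_list] map_cong refl) (simp add: real of_real_Re)
  also have "\<dots> = map_poly complex_of_real (\<Prod>a\<leftarrow>map Re cs. [:- a, 1:])"
    by (simp add: map_poly_hom.hom_prod_list o_def)
  finally have "char_poly A = (\<Prod>a\<leftarrow>map Re cs. [:- a, 1:])"
    by simp
  with cs(2) show ?thesis by (metis length_map)
qed

text \<open>By \<open>proots_linear_prod\<close> the list only reorders the roots of a complete
  splitting, so it holds all \<open>n\<close> eigenvalues with multiplicity.\<close>

lemma eigenvalues_desc:
  shows "char_poly A = (\<Prod>a\<leftarrow>eigenvalues_desc A. [:- a, 1:])"
    and "length (eigenvalues_desc A) = n"
    and "i \<le> j \<Longrightarrow> j < n \<Longrightarrow> eigenvalues_desc A ! j \<le> eigenvalues_desc A ! i"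
proof -
  obtain as where as: "char_poly A = (\<Prod>a\<leftarrow>as. [:- a, 1:])" "length as = n"
    using char_poly_splits by blast
  have ms: "mset (eigenvalues_desc A) = mset as"
    by (simp add: eigenvalues_desc_def as(1) proots_linear_prod)
  show len: "length (eigenvalues_desc A) = n"
    using mset_eq_length [OF ms] as(2) by simp
  show "char_poly A = (\<Prod>a\<leftarrow>eigenvalues_desc A. [:- a, 1:])"
    unfolding as(1) by (metis ms mset_map prod_mset_prod_list)
  have "sorted (rev (eigenvalues_desc A))"
    by (simp add: eigenvalues_desc_def)
  then show "eigenvalues_desc A ! j \<le> eigenvalues_desc A ! i" if "i \<le> j" "j < n"
    using that len by (simp add: sorted_rev_nth_mono)
qed

section \<open>Orthonormal eigenbasis by Gram--Schmidt\<close>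

context
  notes sum.cong [fundef_cong]
begin

text \<open>Gram--Schmidt without normalisation, for \<open>ip\<close>. The congruence rule for sums
  tells the termination proof that the recursive calls have \<open>j < k\<close>.\<close>

fun orthogonalized :: "(nat \<Rightarrow> nat \<Rightarrow> real) \<Rightarrow> nat \<Rightarrow> nat \<Rightarrow> real" where
  "orthogonalized p k = (\<lambda>i. p k i - (\<Sum>j<k.
     ip (p k) (orthogonalized p j) / ip (orthogonalized p j) (orthogonalized p j) * orthogonalized p j i))"

end

declare orthogonalized.simps [simp del]

lemma orthogonalized_orthogonal:
  assumes "\<And>j. j < m \<Longrightarrow> ip (orthogonalized p j) (orthogonalized p j) \<noteq> 0" "j < k" "k < m"
  shows "ip (orthogonalized p k) (orthogonalized p j) = 0"
  using assms(2,3)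
proof (induction k arbitrary: j rule: less_induct)
  case (less k)
  let ?u = "orthogonalized p"
  \<comment> \<open>The induction hypothesis applies at the larger of the two indices. Hence the
    earlier vectors are mutually orthogonal and only the term \<open>l = j\<close> of the projection
    sum survives.\<close>
  have orth: "ip (?u l) (?u j) = 0" if "l < k" "l \<noteq> j" for l
    using that less.IH [of l j] less.IH [of j l] less.prems ip_commute [of "?u l" "?u j"]
    by (cases "l < j") auto
  have "ip (?u k) (?u j) = ip (p k) (?u j) -
      (\<Sum>l<k. ip (p k) (?u l) / ip (?u l) (?u l) * ip (?u l) (?u j))"
    by (subst orthogonalized.simps) (simp only: ip_diff_left ip_sum_left ip_scale_left)
  also have "(\<Sum>l<k. ip (p k) (?u l) / ip (?u l) (?u l) * ip (?u l) (?u j)) =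
      (\<Sum>l<k. if l = j then ip (p k) (?u j) else 0)"
    using assms(1) [of j] less.prems by (intro sum.cong) (auto simp: orth)
  also have "\<dots> = ip (p k) (?u j)"
    using less.prems by simp
  finally show ?case by simp
qed

text \<open>
  The Schur decomposition yields a flag of invariant subspaces in the prescribed order of the
  eigenvalues. Self-adjointness forces the orthogonalised flag basis to consist of eigenvectors:
  the defect \<open>r\<close> below lies in the span of the earlier basis vectors and is orthogonal to it.
\<close>

lemma eigenbasis:
  obtains u where
    "\<And>j i. j < n \<Longrightarrow> i < n \<Longrightarrow> app (u j) i = eigenvalues_desc A ! j * u j i"
    "\<And>i j. i < n \<Longrightarrow> j < n \<Longrightarrow> ip (u i) (u j) = (if i = j then 1 else 0)"
proof -
  define es where "es = eigenvalues_desc A"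
  obtain B P Q where BPQ: "schur_decomposition A es = (B, P, Q)"
    by (cases "schur_decomposition A es")
  have schur: "similar_mat_wit A B P Q" "upper_triangular B" "diag_mat B = es"
    using schur_decomposition [OF carrier _ BPQ] eigenvalues_desc(1) by (auto simp: es_def)
  note wit = similar_mat_witD2 [OF carrier schur(1)]
  define p where "p k i = P $$ (i, k)" for k i
  let ?u = "orthogonalized p"
  define c where "c k j = ip (p k) (?u j) / ip (?u j) (?u j)" for k j
  have u: "?u k i = p k i - (\<Sum>j<k. c k j * ?u j i)" for k i
    unfolding c_def by (subst orthogonalized.simps) (rule refl)
  \<comment> \<open>The rows of \<open>Q\<close> form the basis dual to the columns
    \<open>p k\<close> of \<open>P\<close>; this encodes the linear independence of the
    columns.\<close>
  have QP: "(\<Sum>i<n. Q $$ (m, i) * p k i) = (if m = k then 1 else 0)" if "m < n" "k < n" for m k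
    using arg_cong [OF wit(2), of "\<lambda>M. M $$ (m, k)"] that wit(6,7)
    by (simp add: scalar_prod_def lessThan_atLeast0 p_def)
  have AP: "A * P = P * B"
  proof -
    have "A * P = P * B * (Q * P)"
      using wit by (simp add: assoc_mult_mat [of _ n n _ n _ n])
    then show ?thesis using wit by simp
  qed
  have Bdiag: "B $$ (k, k) = es ! k" if "k < n" for k
    using that wit(5) schur(3) by (auto simp: diag_mat_def)
  \<comment> \<open>Column \<open>k\<close> of the upper triangular \<open>B\<close> stops at row
    \<open>k\<close>, so \<open>p k\<close> is an eigenvector up to a combination of earlier
    columns.\<close>
  have app_p: "app (p k) i = es ! k * p k i + (\<Sum>j<k. B $$ (j, k) * p j i)"
    if "k < n" "i < n" for k i
  proof -
    have "app (p k) i = (\<Sum>j<n. B $$ (j, k) * p j i)"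
      using arg_cong [OF AP, of "\<lambda>M. M $$ (i, k)"] that wit(4,5,6) carrier
      by (simp add: scalar_prod_def lessThan_atLeast0 p_def app_def mult_ac)
    also have "\<dots> = (\<Sum>j<Suc k. B $$ (j, k) * p j i)"
      using that wit(5) schur(2) by (intro sum.mono_neutral_right) auto
    finally show ?thesis using Bdiag [OF that(1)] by simp
  qed
  \<comment> \<open>Subtracting earlier vectors does not change the pairing with rows
    \<open>m \<ge> k\<close> of \<open>Q\<close>. The value 1 at \<open>m = k\<close> shows that no
    orthogonalised vector vanishes, which is \<open>nz\<close>.\<close>
  have dual: "(\<Sum>i<n. Q $$ (m, i) * ?u k i) = (if m = k then 1 else 0)" if "k \<le> m" "m < n" for m k
    using that
  proof (induction k rule: less_induct)
    case (less k)
    have "(\<Sum>i<n. Q $$ (m, i) * ?u k i) =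
        (\<Sum>i<n. Q $$ (m, i) * p k i) - (\<Sum>i<n. \<Sum>j<k. c k j * (Q $$ (m, i) * ?u j i))"
      by (subst u) (simp add: algebra_simps sum_subtractf sum_distrib_left)
    also have "(\<Sum>i<n. \<Sum>j<k. c k j * (Q $$ (m, i) * ?u j i)) =
        (\<Sum>j<k. c k j * (\<Sum>i<n. Q $$ (m, i) * ?u j i))"
      by (subst sum.swap) (simp add: sum_distrib_left)
    also have "\<dots> = 0"
      using less by (intro sum.neutral) auto
    finally show ?case using QP less.prems by simp
  qed
  have nz: "ip (?u k) (?u k) \<noteq> 0" if "k < n" for k
  proof
    assume "ip (?u k) (?u k) = 0"
    then have "(\<Sum>i<n. Q $$ (k, i) * ?u k i) = 0"
      by (intro sum.neutral) (simp add: ip_eq_0)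
    with dual [of k k] that show False by simp
  qed
  note orth = orthogonalized_orthogonal [of n p, OF nz]
  have eig: "app (?u k) i = es ! k * ?u k i" if "k < n" "i < n" for k i
    using that
  proof (induction k arbitrary: i rule: less_induct)
    case (less k)
    define r where "r i = app (?u k) i - es ! k * ?u k i" for i
    have r: "r i = (\<Sum>j<k. B $$ (j, k) * p j i) - (\<Sum>j<k. c k j * (es ! j - es ! k) * ?u j i)"
      if "i < n" for i
    proof -
      have "app (?u k) i = app (p k) i - (\<Sum>j<k. c k j * app (?u j) i)"
        by (subst u [abs_def]) (simp only: app_diff app_sum app_scale)
      also have "(\<Sum>j<k. c k j * app (?u j) i) = (\<Sum>j<k. c k j * es ! j * ?u j i)"
        using less that by (intro sum.cong) auto
      finally have "app (?u k) i =
          es ! k * p k i + (\<Sum>j<k. B $$ (j, k) * p j i) - (\<Sum>j<k. c k j * es ! j * ?u j i)"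
        using app_p [of k i] less.prems that by simp
      moreover have "es ! k * ?u k i = es ! k * p k i - (\<Sum>j<k. c k j * es ! k * ?u j i)"
        by (subst u) (simp add: algebra_simps sum_distrib_left)
      ultimately show ?thesis
        by (simp add: r_def algebra_simps sum_subtractf)
    qed
    have ru: "ip r (?u j) = 0" if "j < k" for j
    proof -
      have "ip r (?u j) = ip (app (?u k)) (?u j) - es ! k * ip (?u k) (?u j)"
        unfolding r_def by (simp only: ip_diff_left ip_scale_left)
      also have "ip (app (?u k)) (?u j) = ip (?u k) (\<lambda>i. es ! j * ?u j i)"
        unfolding app_sym using less that by (intro ip_cong) auto
      also have "\<dots> = es ! j * ip (?u k) (?u j)"
        by (rule ip_scale_right)
      finally show ?thesis using orth that less.prems by simp
    qed
    have rp: "ip r (p j) = 0" if "j < k" for j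
    proof -
      have "ip (p j) r = ip (\<lambda>i. ?u j i + (\<Sum>l<j. c j l * ?u l i)) r"
        by (intro ip_cong) (simp_all add: u [of j])
      also have "\<dots> = ip (?u j) r + (\<Sum>l<j. c j l * ip (?u l) r)"
        by (simp only: ip_add_left ip_sum_left ip_scale_left)
      finally show ?thesis using ru that by (simp add: ip_commute [of _ r])
    qed
    have "ip r r = ip (\<lambda>i. (\<Sum>j<k. B $$ (j, k) * p j i) - (\<Sum>j<k. c k j * (es ! j - es ! k) * ?u j i)) r"
      by (intro ip_cong) (simp_all add: r)
    also have "\<dots> = (\<Sum>j<k. B $$ (j, k) * ip (p j) r) - (\<Sum>j<k. c k j * (es ! j - es ! k) * ip (?u j) r)"
      by (simp only: ip_diff_left ip_sum_left ip_scale_left)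
    also have "\<dots> = 0"
      using ru rp by (simp add: ip_commute [of _ r])
    finally have "r i = 0" using ip_eq_0 less.prems by blast
    then show ?case by (simp add: r_def)
  qed
  define v where "v k i = (1 / sqrt (ip (?u k) (?u k))) * ?u k i" for k i
  have "app (v j) i = es ! j * v j i" if "j < n" "i < n" for j i
    using eig that unfolding v_def app_scale by simp
  moreover have "ip (v i) (v j) = (if i = j then 1 else 0)" if "i < n" "j < n" for i j
  proof -
    have v: "ip (v i) (v j) = ip (?u i) (?u j) / (sqrt (ip (?u i) (?u i)) * sqrt (ip (?u j) (?u j)))"
      unfolding v_def ip_scale_left ip_scale_right by simp
    show ?thesis
    proof (cases "i = j")
      case True
      then show ?thesis using v nz [OF that(1)] ip_nonneg [of "?u i"] by simp
    next
      case False
      then have "ip (?u i) (?u j) = 0"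
        using orth [of i j] orth [of j i] that ip_commute [of "?u i" "?u j"] by (cases "i < j") auto
      with v False show ?thesis by simp
    qed
  qed
  ultimately show thesis using that [of v] unfolding es_def by blast
qed

text \<open>Scaling by \<open>sqrt (w k)\<close> turns orthonormality into the statement that the
  transpose of the square matrix \<open>M\<close> is a left inverse. It is then a right inverse too,
  which is the completeness relation needed for the expansion.\<close>

lemma parseval:
  assumes "\<And>i j. i < n \<Longrightarrow> j < n \<Longrightarrow> ip (u i) (u j) = (if i = j then 1 else 0)"
  shows "ip f g = (\<Sum>j<n. ip f (u j) * ip g (u j))"
proof -
  define M where "M = mat n n (\<lambda>(k, j). sqrt (w k) * u j k)"
  have M: "M \<in> carrier_mat n n" "transpose_mat M \<in> carrier_mat n n"
    by (simp_all add: M_def)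
  have sq: "sqrt (w k) * sqrt (w k) = w k" if "k < n" for k
    using w_pos [OF that] by simp
  have "transpose_mat M * M = 1\<^sub>m n"
  proof (rule eq_matI)
    fix i j assume "i < dim_row (1\<^sub>m n :: real mat)" "j < dim_col (1\<^sub>m n :: real mat)"
    then have ij: "i < n" "j < n" by auto
    have "(transpose_mat M * M) $$ (i, j) = (\<Sum>k<n. (sqrt (w k) * sqrt (w k)) * u i k * u j k)"
      using ij by (simp add: M_def scalar_prod_def lessThan_atLeast0 mult_ac
          del: real_sqrt_mult_self)
    also have "\<dots> = ip (u i) (u j)"
      unfolding ip_def by (intro sum.cong) (simp_all add: w_pos less_imp_le)
    finally show "(transpose_mat M * M) $$ (i, j) = 1\<^sub>m n $$ (i, j)"
      using assms ij by simp
  qed (use M in auto)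
  then have MM: "M * transpose_mat M = 1\<^sub>m n"
    using mat_mult_left_right_inverse M by blast
  have complete: "(\<Sum>j<n. sqrt (w k) * u j k * (sqrt (w l) * u j l)) = (if k = l then 1 else 0)"
    if "k < n" "l < n" for k l
    using arg_cong [OF MM, of "\<lambda>X. X $$ (k, l)"] that
    by (simp add: M_def scalar_prod_def lessThan_atLeast0)
  have "(\<Sum>j<n. ip f (u j) * ip g (u j)) =
      (\<Sum>j<n. \<Sum>k<n. \<Sum>l<n. w k * f k * u j k * (w l * g l * u j l))"
    by (simp add: ip_def sum_product)
  also have "\<dots> = (\<Sum>k<n. \<Sum>l<n. \<Sum>j<n. w k * f k * u j k * (w l * g l * u j l))"
    by (subst sum.swap) (intro sum.cong refl sum.swap)
  also have "\<dots> = (\<Sum>k<n. \<Sum>l<n. if k = l then w k * f k * g k else 0)"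
  proof (intro sum.cong refl)
    fix k l assume "k \<in> {..<n}" "l \<in> {..<n}"
    then have kl: "k < n" "l < n" by auto
    have "w k * f k * u j k * (w l * g l * u j l) =
        sqrt (w k) * f k * (sqrt (w l) * g l) * (sqrt (w k) * u j k * (sqrt (w l) * u j l))" for j
    proof -
      have "sqrt (w k) * f k * (sqrt (w l) * g l) * (sqrt (w k) * u j k * (sqrt (w l) * u j l)) =
          (sqrt (w k) * sqrt (w k)) * (sqrt (w l) * sqrt (w l)) * (f k * g l * u j k * u j l)"
        by (simp only: mult_ac)
      then show ?thesis by (simp only: sq kl mult_ac)
    qed
    then have "(\<Sum>j<n. w k * f k * u j k * (w l * g l * u j l)) =
        sqrt (w k) * f k * (sqrt (w l) * g l) * (\<Sum>j<n. sqrt (w k) * u j k * (sqrt (w l) * u j l))"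
      by (simp only: sum_distrib_left)
    then show "(\<Sum>j<n. w k * f k * u j k * (w l * g l * u j l)) = (if k = l then w k * f k * g k else 0)"
      using kl w_pos [OF kl(2)] by (simp add: complete)
  qed
  also have "\<dots> = ip f g"
    by (simp add: ip_def)
  finally show ?thesis by simp
qed

section \<open>Variational bounds on the second eigenvalue\<close>

lemma dform_spectral:
  assumes "\<And>j i. j < n \<Longrightarrow> i < n \<Longrightarrow> app (u j) i = e j * u j i"
    and "\<And>i j. i < n \<Longrightarrow> j < n \<Longrightarrow> ip (u i) (u j) = (if i = j then 1 else 0)"
  shows "dform f = (\<Sum>j<n. (1 - e j) * (ip f (u j))\<^sup>2)"
proof -
  have "ip (app f) (u j) = e j * ip f (u j)" if "j < n" for j
  proof -
    have "ip (app f) (u j) = ip f (\<lambda>i. e j * u j i)"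
      unfolding app_sym using assms(1) that by (intro ip_cong) auto
    also have "\<dots> = e j * ip f (u j)"
      by (rule ip_scale_right)
    finally show ?thesis .
  qed
  then show ?thesis
    unfolding dform_def ip_commute [of f "app f"]
    by (subst (1 2) parseval [of u, OF assms(2)])
      (simp_all add: algebra_simps power2_eq_square sum_subtractf)
qed

text \<open>One half of the Courant--Fischer principle. The plane spanned by the first two
  eigenvectors meets the hyperplane \<open>f r = 0\<close> in a nonzero \<open>f\<close>, and on
  that plane \<open>dform f\<close> is at most \<open>(1 - e 1) * ip f f\<close>. List positions
  start at 0, so \<open>e 1\<close> is \<open>eigval 2 A\<close>.\<close>

lemma second_eigval_le:
  assumes "n \<ge> 2" "r < n" and ineq: "\<And>f. f r = 0 \<Longrightarrow> g * ip f f \<le> dform f"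
  shows "eigval 2 A \<le> 1 - g"
proof -
  obtain u where eig: "\<And>j i. j < n \<Longrightarrow> i < n \<Longrightarrow> app (u j) i = eigenvalues_desc A ! j * u j i"
    and orth: "\<And>i j. i < n \<Longrightarrow> j < n \<Longrightarrow> ip (u i) (u j) = (if i = j then 1 else 0)"
    using eigenbasis by blast
  define e where "e j = eigenvalues_desc A ! j" for j
  obtain a b where ab: "a * u 0 r + b * u 1 r = 0" "a \<noteq> 0 \<or> b \<noteq> 0"
  proof (cases "u 0 r = 0")
    case True
    then show ?thesis using that [of 1 0] by simp
  next
    case False
    then show ?thesis using that [of "u 1 r" "- u 0 r"] by simp
  qed
  define f where "f k = a * u 0 k + b * u 1 k" for k
  have coeff: "ip f (u j) = (if j = 0 then a else if j = 1 then b else 0)" if "j < n" for j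
    unfolding f_def ip_add_left ip_scale_left using orth that assms(1) by simp
  have sum2: "(\<Sum>j<n. if j = 0 then x else if j = 1 then y else 0) = x + y" for x y :: real
  proof -
    have "(\<Sum>j<n. if j = 0 then x else if j = 1 then y else 0) =
        (\<Sum>j<2::nat. if j = 0 then x else if j = 1 then y else 0)"
      using assms(1) by (intro sum.mono_neutral_right) auto
    then show ?thesis by (simp add: numeral_2_eq_2)
  qed
  have ff: "ip f f = a\<^sup>2 + b\<^sup>2"
    unfolding sum2 [symmetric]
    by (subst parseval [of u, OF orth]) (auto intro!: sum.cong simp: coeff power2_eq_square)
  have "dform f = (\<Sum>j<n. (1 - e j) * (ip f (u j))\<^sup>2)"
    using dform_spectral [of u e] eig orth by (simp add: e_def)
  also have "\<dots> = (1 - e 0) * a\<^sup>2 + (1 - e 1) * b\<^sup>2"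
    unfolding sum2 [symmetric] by (intro sum.cong) (auto simp: coeff)
  also have "\<dots> \<le> (1 - e 1) * (a\<^sup>2 + b\<^sup>2)"
    using eigenvalues_desc(3) [of 0 1] assms(1)
    by (simp add: e_def algebra_simps mult_right_mono)
  finally have "g * (a\<^sup>2 + b\<^sup>2) \<le> (1 - e 1) * (a\<^sup>2 + b\<^sup>2)"
    using ineq [of f] ab(1) by (simp add: ff f_def)
  moreover have "a\<^sup>2 + b\<^sup>2 > 0"
    using ab(2) by (simp add: sum_power2_gt_zero_iff)
  ultimately show ?thesis
    by (simp add: eigval_def e_def)
qed

text \<open>The other half: the plane spanned by \<open>f\<close> and \<open>g\<close> contains a
  nonzero \<open>x\<close> orthogonal to the first eigenvector \<open>u 0\<close>. Its expansion
  involves only \<open>e j\<close> with \<open>j \<ge> 1\<close>, so \<open>dform x\<close> is at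
  least \<open>(1 - e 1) * ip x x\<close>.\<close>

lemma second_eigval_ge:
  assumes "n \<ge> 2"
    and ineq: "\<And>a b. dform (\<lambda>k. a * f k + b * g k) \<le> h * ip (\<lambda>k. a * f k + b * g k) (\<lambda>k. a * f k + b * g k)"
    and indep: "\<And>a b. (\<And>k. k < n \<Longrightarrow> a * f k + b * g k = 0) \<Longrightarrow> a = 0 \<and> b = 0"
  shows "1 - h \<le> eigval 2 A"
proof -
  obtain u where eig: "\<And>j i. j < n \<Longrightarrow> i < n \<Longrightarrow> app (u j) i = eigenvalues_desc A ! j * u j i"
    and orth: "\<And>i j. i < n \<Longrightarrow> j < n \<Longrightarrow> ip (u i) (u j) = (if i = j then 1 else 0)"
    using eigenbasis by blast
  define e where "e j = eigenvalues_desc A ! j" for j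
  obtain a b where ab: "a * ip f (u 0) + b * ip g (u 0) = 0" "a \<noteq> 0 \<or> b \<noteq> 0"
  proof (cases "ip f (u 0) = 0")
    case True
    then show ?thesis using that [of 1 0] by simp
  next
    case False
    then show ?thesis using that [of "ip g (u 0)" "- ip f (u 0)"] by simp
  qed
  define x where "x k = a * f k + b * g k" for k
  have x0: "ip x (u 0) = 0"
    unfolding x_def ip_add_left ip_scale_left by (rule ab(1))
  have "ip x x \<noteq> 0"
    using ab(2) indep [of a b] ip_eq_0 [of x] by (auto simp: x_def)
  then have pos: "ip x x > 0"
    using ip_nonneg [of x] by simp
  have "(1 - e 1) * ip x x = (\<Sum>j<n. (1 - e 1) * (ip x (u j))\<^sup>2)"
    by (subst parseval [of u, OF orth]) (simp_all add: sum_distrib_left power2_eq_square)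
  also have "\<dots> \<le> (\<Sum>j<n. (1 - e j) * (ip x (u j))\<^sup>2)"
  proof (rule sum_mono)
    fix j assume "j \<in> {..<n}"
    then show "(1 - e 1) * (ip x (u j))\<^sup>2 \<le> (1 - e j) * (ip x (u j))\<^sup>2"
      using x0 eigenvalues_desc(3) [of 1 j] by (cases "j = 0") (auto simp: e_def mult_right_mono)
  qed
  also have "\<dots> = dform x"
    using dform_spectral [of u e] eig orth by (simp add: e_def)
  also have "\<dots> \<le> h * ip x x"
    unfolding x_def by (rule ineq)
  finally have "1 - e 1 \<le> h" using pos by simp
  then show ?thesis
    by (simp add: eigval_def e_def)
qed

text \<open>Expanding the square, each of the two pure terms sums to \<open>ip f f\<close>, the
  first by the row sums and the second after exchanging indices by detailed balance.\<close>

lemma dform_dirichlet: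
  assumes "\<And>i. i < n \<Longrightarrow> (\<Sum>j<n. A $$ (i, j)) = 1"
  shows "dform f = 1 / 2 * (\<Sum>i<n. \<Sum>j<n. w i * A $$ (i, j) * (f i - f j)\<^sup>2)"
proof -
  have 1: "(\<Sum>i<n. \<Sum>j<n. w i * A $$ (i, j) * (f i)\<^sup>2) = ip f f"
    unfolding ip_def
  proof (intro sum.cong refl)
    fix i assume "i \<in> {..<n}"
    then show "(\<Sum>j<n. w i * A $$ (i, j) * (f i)\<^sup>2) = w i * f i * f i"
      using assms [of i] by (simp add: sum_distrib_left [symmetric] sum_distrib_right [symmetric] power2_eq_square)
  qed
  have "(\<Sum>i<n. \<Sum>j<n. w i * A $$ (i, j) * (f j)\<^sup>2) = (\<Sum>i<n. \<Sum>j<n. w j * A $$ (j, i) * (f j)\<^sup>2)"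
    by (intro sum.cong refl) (simp add: balance)
  also have "\<dots> = (\<Sum>j<n. \<Sum>i<n. w j * A $$ (j, i) * (f j)\<^sup>2)"
    by (rule sum.swap)
  finally have 2: "(\<Sum>i<n. \<Sum>j<n. w i * A $$ (i, j) * (f j)\<^sup>2) = ip f f"
    using 1 by simp
  have 3: "(\<Sum>i<n. \<Sum>j<n. w i * A $$ (i, j) * (f i * f j)) = ip f (app f)"
    by (simp add: ip_def app_def sum_distrib_left mult_ac)
  have "(\<Sum>i<n. \<Sum>j<n. w i * A $$ (i, j) * (f i - f j)\<^sup>2) =
      (\<Sum>i<n. \<Sum>j<n. w i * A $$ (i, j) * (f i)\<^sup>2) + (\<Sum>i<n. \<Sum>j<n. w i * A $$ (i, j) * (f j)\<^sup>2)
      - 2 * (\<Sum>i<n. \<Sum>j<n. w i * A $$ (i, j) * (f i * f j))"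
    unfolding sum_distrib_left sum.distrib [symmetric] sum_subtractf [symmetric]
    by (intro sum.cong refl) (simp add: power2_eq_square algebra_simps)
  then show ?thesis
    unfolding 1 2 3 dform_def by simp
qed

end

section \<open>Dirichlet forms of kernels on the state space\<close>

text \<open>The double sum runs over ordered pairs and so meets every edge twice; hence the factor
  \<open>1 / 2\<close>.\<close>

definition dirichlet :: "int set \<Rightarrow> (int \<Rightarrow> real) \<Rightarrow> (int \<Rightarrow> int \<Rightarrow> real) \<Rightarrow> (int \<Rightarrow> real) \<Rightarrow> real" where
  "dirichlet X W K f = 1 / 2 * (\<Sum>x\<in>X. \<Sum>y\<in>X. W x * K x y * (f x - f y)\<^sup>2)"

lemma finite_state_space [simp]: "finite (state_space J)"
  by (simp add: state_space_def)

lemma sum_state_space: "(\<Sum>i<Suc (2 * J). F (int i - int J)) = (\<Sum>x\<in>state_space J. F x)"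
  by (rule sum.reindex_bij_witness [of _ "\<lambda>x. nat (x + int J)" "\<lambda>i. int i - int J"])
    (auto simp: state_space_def)

lemma kernel_mat_carrier [simp]: "kernel_mat J K \<in> carrier_mat (Suc (2 * J)) (Suc (2 * J))"
  by (simp add: kernel_mat_def)

lemma kernel_mat_dim [simp]:
  "dim_row (kernel_mat J K) = Suc (2 * J)" "dim_col (kernel_mat J K) = Suc (2 * J)"
  by (simp_all add: kernel_mat_def)

lemma kernel_mat_index [simp]:
  "i < Suc (2 * J) \<Longrightarrow> j < Suc (2 * J) \<Longrightarrow> kernel_mat J K $$ (i, j) = K (int i - int J) (int j - int J)"
  by (simp add: kernel_mat_def)

lemma kernel_mat_mult:
  "kernel_mat J K * kernel_mat J L = kernel_mat J (\<lambda>x y. \<Sum>z\<in>state_space J. K x z * L z y)"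
proof (rule eq_matI)
  fix i j
  assume "i < dim_row (kernel_mat J (\<lambda>x y. \<Sum>z\<in>state_space J. K x z * L z y))"
    "j < dim_col (kernel_mat J (\<lambda>x y. \<Sum>z\<in>state_space J. K x z * L z y))"
  then have ij: "i < Suc (2 * J)" "j < Suc (2 * J)"
    by (simp_all add: kernel_mat_def)
  then show "(kernel_mat J K * kernel_mat J L) $$ (i, j) =
      kernel_mat J (\<lambda>x y. \<Sum>z\<in>state_space J. K x z * L z y) $$ (i, j)"
    unfolding sum_state_space [symmetric] by (simp add: kernel_mat_def scalar_prod_def lessThan_atLeast0)
qed (simp_all add: kernel_mat_def)

locale reversible_kernel =
  fixes J :: nat and W :: "int \<Rightarrow> real" and K :: "int \<Rightarrow> int \<Rightarrow> real"
  assumes J_pos: "J \<ge> 1"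
    and W_pos: "x \<in> state_space J \<Longrightarrow> W x > 0"
    and detailed_balance: "x \<in> state_space J \<Longrightarrow> y \<in> state_space J \<Longrightarrow> W x * K x y = W y * K y x"
    and row_sum: "x \<in> state_space J \<Longrightarrow> (\<Sum>y\<in>state_space J. K x y) = 1"
    and K_nonneg: "x \<in> state_space J \<Longrightarrow> y \<in> state_space J \<Longrightarrow> K x y \<ge> 0"
begin

sublocale mat: reversible_mat "Suc (2 * J)" "kernel_mat J K" "\<lambda>i. W (int i - int J)"
  by unfold_locales (auto simp: state_space_def intro!: W_pos detailed_balance)

abbreviation energy_form :: "(int \<Rightarrow> real) \<Rightarrow> real" where
  "energy_form \<equiv> dirichlet (state_space J) W K"

lemma ip_kernel: "mat.ip (\<lambda>k. f (int k - int J)) (\<lambda>k. f (int k - int J)) = (\<Sum>x\<in>state_space J. W x * (f x)\<^sup>2)"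
  unfolding mat.ip_def sum_state_space [of "\<lambda>x. W x * f x * f x"] by (simp add: power2_eq_square mult.assoc)

lemma dform_kernel: "mat.dform (\<lambda>k. f (int k - int J)) = energy_form f"
proof -
  have "(\<Sum>j<Suc (2 * J). kernel_mat J K $$ (i, j)) = 1" if "i < Suc (2 * J)" for i
  proof -
    have "(\<Sum>j<Suc (2 * J). kernel_mat J K $$ (i, j)) = (\<Sum>j<Suc (2 * J). K (int i - int J) (int j - int J))"
      using that by (intro sum.cong) auto
    also have "\<dots> = 1"
      unfolding sum_state_space using that by (intro row_sum) (auto simp: state_space_def)
    finally show ?thesis .
  qed
  then have "mat.dform (\<lambda>k. f (int k - int J)) = 1 / 2 * (\<Sum>i<Suc (2 * J). \<Sum>j<Suc (2 * J).
      W (int i - int J) * K (int i - int J) (int j - int J) * (f (int i - int J) - f (int j - int J))\<^sup>2)"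
    by (subst mat.dform_dirichlet) (simp_all del: sum.lessThan_Suc)
  then show ?thesis
    unfolding sum_state_space [of "\<lambda>y. W (int i - int J) * K (int i - int J) y * (f (int i - int J) - f y)\<^sup>2" for i]
    unfolding sum_state_space [of "\<lambda>x. \<Sum>y\<in>state_space J. W x * K x y * (f x - f y)\<^sup>2"] dirichlet_def .
qed

lemma dirichlet_affine: "energy_form (\<lambda>x. a * f x + b) = a\<^sup>2 * energy_form f"
proof -
  have "(a * f x + b - (a * f y + b))\<^sup>2 = a\<^sup>2 * (f x - f y)\<^sup>2" for x y
    by (simp add: power_mult_distrib [symmetric] algebra_simps)
  then show ?thesis
    by (simp add: dirichlet_def sum_distrib_left mult_ac)
qed

text \<open>The edge occurs as \<open>(x, y)\<close> and as \<open>(y, x)\<close> with equal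
  contributions, which cancels the factor \<open>1 / 2\<close>; all other terms are
  nonnegative.\<close>

lemma edge_le_dirichlet:
  assumes "x \<in> state_space J" "y \<in> state_space J"
  shows "W x * K x y * (f x - f y)\<^sup>2 \<le> energy_form f"
proof -
  define t where "t = (\<lambda>(x, y). W x * K x y * (f x - f y)\<^sup>2)"
  have sym: "t (y, x) = t (x, y)"
    using detailed_balance [OF assms] by (simp add: t_def power2_commute)
  have nonneg: "t q \<ge> 0" if "q \<in> state_space J \<times> state_space J" for q
    using that W_pos K_nonneg by (auto simp: t_def less_imp_le)
  have "2 * t (x, y) \<le> (\<Sum>q\<in>state_space J \<times> state_space J. t q)"
  proof (cases "x = y")
    case True
    then have "t (x, y) = 0" by (simp add: t_def)
    then show ?thesis by (simp add: sum_nonneg nonneg)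
  next
    case False
    then have "2 * t (x, y) = (\<Sum>q\<in>{(x, y), (y, x)}. t q)"
      using sym by simp
    also have "\<dots> \<le> (\<Sum>q\<in>state_space J \<times> state_space J. t q)"
      using assms nonneg by (intro sum_mono2) auto
    finally show ?thesis .
  qed
  then show ?thesis
    by (simp add: dirichlet_def t_def sum.cartesian_product)
qed

lemma dirichlet_nonneg: "energy_form f \<ge> 0"
  unfolding dirichlet_def using W_pos K_nonneg by (auto intro!: sum_nonneg simp: less_imp_le)

lemma second_eigval_kernel_le:
  assumes r: "r \<in> state_space J"
    and ineq: "\<And>f. f r = 0 \<Longrightarrow> g * (\<Sum>x\<in>state_space J. W x * (f x)\<^sup>2) \<le> energy_form f"
  shows "eigval 2 (kernel_mat J K) \<le> 1 - g"
proof (rule mat.second_eigval_le [of "nat (r + int J)"])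
  fix f :: "nat \<Rightarrow> real" assume "f (nat (r + int J)) = 0"
  then show "g * mat.ip f f \<le> mat.dform f"
    using ineq [of "\<lambda>x. f (nat (x + int J))"]
    unfolding ip_kernel [symmetric] dform_kernel [symmetric] by simp
qed (use r J_pos in \<open>auto simp: state_space_def\<close>)

text \<open>The test plane is spanned by \<open>\<phi>\<close> and the constants. Constants have no
  energy and both sides are quadratic, so the shifts \<open>\<phi> x + a\<close> cover every
  combination with a nonzero coefficient of \<open>\<phi>\<close>.\<close>

lemma second_eigval_kernel_ge:
  assumes h: "h \<ge> 0" and xy: "x \<in> state_space J" "y \<in> state_space J" "\<phi> x \<noteq> \<phi> y"
    and ineq: "\<And>a. energy_form \<phi> \<le> h * (\<Sum>x\<in>state_space J. W x * (\<phi> x + a)\<^sup>2)"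
  shows "1 - h \<le> eigval 2 (kernel_mat J K)"
proof (rule mat.second_eigval_ge [where f = "\<lambda>k. \<phi> (int k - int J)" and g = "\<lambda>_. 1"])
  fix a b :: real
  have "energy_form (\<lambda>x. a * \<phi> x + b) \<le> h * (\<Sum>x\<in>state_space J. W x * (a * \<phi> x + b)\<^sup>2)"
  proof (cases "a = 0")
    case True
    then show ?thesis
      using h W_pos by (auto simp: dirichlet_def less_imp_le intro!: mult_nonneg_nonneg sum_nonneg)
  next
    case False
    then have "(a * \<phi> x + b)\<^sup>2 = a\<^sup>2 * (\<phi> x + b / a)\<^sup>2" for x
      by (simp add: power_mult_distrib [symmetric] algebra_simps)
    then have eq: "h * (\<Sum>x\<in>state_space J. W x * (a * \<phi> x + b)\<^sup>2) =
        a\<^sup>2 * (h * (\<Sum>x\<in>state_space J. W x * (\<phi> x + b / a)\<^sup>2))"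
      by (simp add: sum_distrib_left mult_ac)
    show ?thesis
      unfolding dirichlet_affine eq by (rule mult_left_mono [OF ineq zero_le_power2])
  qed
  then show "mat.dform (\<lambda>k. a * \<phi> (int k - int J) + b * 1) \<le>
      h * mat.ip (\<lambda>k. a * \<phi> (int k - int J) + b * 1) (\<lambda>k. a * \<phi> (int k - int J) + b * 1)"
    by (simp add: ip_kernel [of "\<lambda>x. a * \<phi> x + b"] dform_kernel [of "\<lambda>x. a * \<phi> x + b"])
next
  fix a b :: real
  assume 0: "\<And>k. k < Suc (2 * J) \<Longrightarrow> a * \<phi> (int k - int J) + b * 1 = 0"
  have "a * \<phi> x + b = 0" "a * \<phi> y + b = 0"
    using 0 [of "nat (x + int J)"] 0 [of "nat (y + int J)"] xy(1,2) by (auto simp: state_space_def)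
  then show "a = 0 \<and> b = 0"
    using xy(3) by (metis add_right_cancel mult_eq_0_iff mult_left_cancel add_0)
qed (use J_pos in auto)

text \<open>The bound \<open>(f x - f y)\<^sup>2 \<le> 2 * (f x)\<^sup>2 + 2 * (f y)\<^sup>2\<close>
  gives \<open>h = 2\<close> for every test function. It serves to keep the relaxation time of the
  mixture away from 0.\<close>

lemma second_eigval_kernel_ge_minus_one: "- 1 \<le> eigval 2 (kernel_mat J K)"
proof -
  have "energy_form f \<le> 2 * (\<Sum>x\<in>state_space J. W x * (f x)\<^sup>2)" for f
  proof -
    have 1: "(\<Sum>x\<in>state_space J. \<Sum>y\<in>state_space J. W x * K x y * (f x)\<^sup>2) = (\<Sum>x\<in>state_space J. W x * (f x)\<^sup>2)"
      by (intro sum.cong refl) (simp add: sum_distrib_left [symmetric] sum_distrib_right [symmetric] row_sum)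
    have "(\<Sum>x\<in>state_space J. \<Sum>y\<in>state_space J. W x * K x y * (f y)\<^sup>2) =
        (\<Sum>x\<in>state_space J. \<Sum>y\<in>state_space J. W y * K y x * (f y)\<^sup>2)"
      by (intro sum.cong refl) (simp add: detailed_balance)
    also have "\<dots> = (\<Sum>y\<in>state_space J. \<Sum>x\<in>state_space J. W y * K y x * (f y)\<^sup>2)"
      by (rule sum.swap)
    finally have 2: "(\<Sum>x\<in>state_space J. \<Sum>y\<in>state_space J. W x * K x y * (f y)\<^sup>2) =
        (\<Sum>x\<in>state_space J. W x * (f x)\<^sup>2)"
      using 1 by simp
    have "(\<Sum>x\<in>state_space J. \<Sum>y\<in>state_space J. W x * K x y * (f x - f y)\<^sup>2) \<le>
        (\<Sum>x\<in>state_space J. \<Sum>y\<in>state_space J. 2 * (W x * K x y * (f x)\<^sup>2) + 2 * (W x * K x y * (f y)\<^sup>2))"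
    proof (intro sum_mono)
      fix x y assume "x \<in> state_space J" "y \<in> state_space J"
      then have "W x * K x y \<ge> 0" by (simp add: W_pos K_nonneg less_imp_le)
      moreover have "(f x - f y)\<^sup>2 \<le> 2 * (f x)\<^sup>2 + 2 * (f y)\<^sup>2"
        using sum_squares_ge_zero [of "f x + f y" 0] by (simp add: power2_eq_square algebra_simps)
      ultimately have "W x * K x y * (f x - f y)\<^sup>2 \<le> W x * K x y * (2 * (f x)\<^sup>2 + 2 * (f y)\<^sup>2)"
        by (rule mult_left_mono [rotated])
      then show "W x * K x y * (f x - f y)\<^sup>2 \<le> 2 * (W x * K x y * (f x)\<^sup>2) + 2 * (W x * K x y * (f y)\<^sup>2)"
        by (simp add: algebra_simps)
    qed
    also have "\<dots> = 4 * (\<Sum>x\<in>state_space J. W x * (f x)\<^sup>2)"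
      by (simp add: sum.distrib sum_distrib_left [symmetric] 1 2)
    finally show ?thesis by (simp add: dirichlet_def)
  qed
  \<comment> \<open>Any nonconstant test function would do. The factor 1 gives the affine shape in
    which \<open>dirichlet_affine\<close> removes the shift from the energy.\<close>
  from this [of "\<lambda>x. 1 * real_of_int x + a" for a]
  have "energy_form real_of_int \<le> 2 * (\<Sum>x\<in>state_space J. W x * (real_of_int x + a)\<^sup>2)" for a
    unfolding dirichlet_affine by simp
  then have "1 - 2 \<le> eigval 2 (kernel_mat J K)"
    using J_pos by (intro second_eigval_kernel_ge [of _ 0 1 real_of_int]) (auto simp: state_space_def)
  then show ?thesis by simp
qed

end

section \<open>The two chains\<close>

definition weight :: "nat \<Rightarrow> real \<Rightarrow> int \<Rightarrow> real" where
  "weight J \<beta> x = exp (- \<beta> * energy J x)"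

definition P_kernel :: "nat \<Rightarrow> real \<Rightarrow> int \<Rightarrow> int \<Rightarrow> real" where
  "P_kernel J \<beta> = metropolis (state_space J) (nn_walk J) (energy J) \<beta>"

text \<open>Conjugation by the permutation matrix relabels both arguments by \<open>psi\<close>; on
  the right this uses that \<open>psi\<close> is an involution, see
  \<open>half_mixture_eq\<close>.\<close>

definition mixture_kernel :: "nat \<Rightarrow> real \<Rightarrow> int \<Rightarrow> int \<Rightarrow> real" where
  "mixture_kernel J \<beta> x y = (P_kernel J \<beta> x y + P_kernel J \<beta> (psi J x) (psi J y)) / 2"

lemma weight_pos [simp]: "weight J \<beta> x > 0"
  by (simp add: weight_def)

lemma weight_psi: "J \<ge> 1 \<Longrightarrow> weight J \<beta> (psi J x) = weight J \<beta> x"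
  by (simp add: weight_def energy_psi)

lemma weight_mono: "\<beta> \<ge> 0 \<Longrightarrow> energy J y \<le> energy J x \<Longrightarrow> weight J \<beta> x \<le> weight J \<beta> y"
  by (simp add: weight_def mult_left_mono)

lemma psi_psi: "J \<ge> 1 \<Longrightarrow> psi J (psi J x) = x"
  by (auto simp: psi_def)

lemma psi_in_state_space: "J \<ge> 1 \<Longrightarrow> x \<in> state_space J \<Longrightarrow> psi J x \<in> state_space J"
  by (auto simp: psi_def state_space_def)

lemma P_kernel_balance: "weight J \<beta> x * P_kernel J \<beta> x y = weight J \<beta> y * P_kernel J \<beta> y x"
proof -
  have "(\<Sum>z\<in>state_space J. exp (- \<beta> * energy J z)) > 0"
    by (rule sum_pos) (auto simp: state_space_def)
  then show ?thesis
    using metropolis_detailed_balance [of "nn_walk J" "state_space J" "energy J" \<beta> x y, OF nn_walk_sym]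
    by (simp add: gibbs_def weight_def P_kernel_def)
qed

text \<open>Only the diagonal needs an argument: at most two neighbours are proposed, each accepted
  with total probability at most \<open>1 / 2\<close>.\<close>

lemma P_kernel_nonneg:
  assumes "\<beta> \<ge> 0"
  shows "P_kernel J \<beta> x y \<ge> 0"
proof (cases "x = y")
  case True
  have "(\<Sum>z\<in>state_space J - {x}. nn_walk J x z * exp (- \<beta> * max 0 (energy J z - energy J x))) \<le>
      (\<Sum>z\<in>state_space J - {x}. if z \<in> {x - 1, x + 1} then 1 / 2 else 0)"
  proof (intro sum_mono)
    fix z assume z: "z \<in> state_space J - {x}"
    have "exp (- \<beta> * max 0 (energy J z - energy J x)) \<le> 1"
      using assms by simp
    then show "nn_walk J x z * exp (- \<beta> * max 0 (energy J z - energy J x)) \<le>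
        (if z \<in> {x - 1, x + 1} then 1 / 2 else 0)"
      using z by (auto simp: nn_walk_def)
  qed
  also have "\<dots> = (\<Sum>z\<in>(state_space J - {x}) \<inter> {x - 1, x + 1}. 1 / 2)"
    by (rule sum.inter_restrict [symmetric]) simp
  also have "\<dots> \<le> (\<Sum>z\<in>{x - 1, x + 1}. 1 / 2)"
    by (rule sum_mono2) auto
  finally show ?thesis
    using True by (simp add: P_kernel_def metropolis_def)
next
  case False
  then show ?thesis by (simp add: P_kernel_def metropolis_def nn_walk_def)
qed

lemma P_kernel_reversible:
  assumes "J \<ge> 1" "\<beta> \<ge> 0"
  shows "reversible_kernel J (weight J \<beta>) (P_kernel J \<beta>)"
  by unfold_locales (use assms P_kernel_balance P_kernel_nonneg in
      \<open>auto simp: P_kernel_def intro!: metropolis_row_sum\<close>)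

lemma mixture_kernel_reversible:
  assumes "J \<ge> 1" "\<beta> \<ge> 0"
  shows "reversible_kernel J (weight J \<beta>) (mixture_kernel J \<beta>)"
proof -
  interpret P: reversible_kernel J "weight J \<beta>" "P_kernel J \<beta>"
    using assms by (rule P_kernel_reversible)
  show ?thesis
  proof
    fix x y
    have "weight J \<beta> x * P_kernel J \<beta> (psi J x) (psi J y) = weight J \<beta> y * P_kernel J \<beta> (psi J y) (psi J x)"
      using P_kernel_balance [of J \<beta> "psi J x" "psi J y"] assms by (simp add: weight_psi)
    then show "weight J \<beta> x * mixture_kernel J \<beta> x y = weight J \<beta> y * mixture_kernel J \<beta> y x"
      using P_kernel_balance [of J \<beta> x y] by (simp add: mixture_kernel_def algebra_simps add_divide_distrib)
  next
    fix x assume x: "x \<in> state_space J"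
    have "(\<Sum>y\<in>state_space J. P_kernel J \<beta> (psi J x) (psi J y)) = (\<Sum>y\<in>state_space J. P_kernel J \<beta> (psi J x) y)"
      by (rule sum.reindex_bij_witness [of _ "psi J" "psi J"])
        (use assms psi_psi psi_in_state_space in auto)
    then show "(\<Sum>y\<in>state_space J. mixture_kernel J \<beta> x y) = 1"
      using P.row_sum [OF x] P.row_sum [OF psi_in_state_space [OF assms(1) x]]
      by (simp add: mixture_kernel_def sum_divide_distrib [symmetric] sum.distrib)
  qed (use assms P_kernel_nonneg in \<open>auto simp: mixture_kernel_def\<close>)
qed

lemma P_mat_eq: "P_mat J \<beta> = kernel_mat J (P_kernel J \<beta>)"
  by (simp add: P_mat_def P_kernel_def)

lemma half_mixture_eq:
  assumes "J \<ge> 1"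
  shows "half_mixture (P_mat J \<beta>) (Q_mat J) = kernel_mat J (mixture_kernel J \<beta>)"
proof -
  have left: "(\<Sum>z\<in>state_space J. (if z = psi J x then 1 else 0) * g z) = g (psi J x)"
    if "x \<in> state_space J" for x and g :: "int \<Rightarrow> real"
    using psi_in_state_space [OF assms that] by (simp add: if_distrib [of "\<lambda>u. u * _"] cong: if_cong)
  have right: "(\<Sum>z\<in>state_space J. g z * (if y = psi J z then 1 else 0)) = g (psi J y)"
    if "y \<in> state_space J" for y and g :: "int \<Rightarrow> real"
  proof -
    have "y = psi J z \<longleftrightarrow> z = psi J y" for z
      using psi_psi [OF assms] by metis
    then show ?thesis
      using psi_in_state_space [OF assms that] by (simp add: if_distrib [of "\<lambda>u. _ * u"] cong: if_cong)
  qed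
  show ?thesis
    unfolding half_mixture_def P_mat_eq Q_mat_def kernel_mat_mult
  proof (rule eq_matI, goal_cases)
    case (1 i j)
    then have ij: "i < Suc (2 * J)" "j < Suc (2 * J)"
      by (simp_all add: kernel_mat_def)
    then have "int i - int J \<in> state_space J" "int j - int J \<in> state_space J"
      by (auto simp: state_space_def)
    with ij show ?case
      by (simp add: left right mixture_kernel_def)
  qed (simp_all add: kernel_mat_def)
qed

section \<open>Edge conductances and bounds on the spectral gaps\<close>

lemma P_kernel_downhill:
  assumes "x \<in> state_space J" "y \<in> state_space J" "y = x + 1 \<or> y = x - 1" "energy J y \<le> energy J x"
  shows "P_kernel J \<beta> x y = 1 / 2"
  using assms by (auto simp: P_kernel_def metropolis_def nn_walk_def max_def)

text \<open>By detailed balance the edge may be read from its higher endpoint, where the move is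
  always accepted.\<close>

lemma P_kernel_conductance:
  assumes "x \<in> state_space J" "y \<in> state_space J" "y = x + 1 \<or> y = x - 1"
  shows "weight J \<beta> x * P_kernel J \<beta> x y = 1 / 2 * exp (- \<beta> * max (energy J x) (energy J y))"
proof (cases "energy J y \<le> energy J x")
  case True
  then show ?thesis using P_kernel_downhill [of x J y \<beta>] assms by (simp add: weight_def max_def)
next
  case False
  then show ?thesis
    unfolding P_kernel_balance [of J \<beta> x y]
    using P_kernel_downhill [of y J x \<beta>] assms by (auto simp: weight_def max_def)
qed

text \<open>The constant collects at most \<open>J + 1\<close> steps to \<open>J\<close>, each
  costing \<open>2 * S\<close> with \<open>S\<^sup>2\<close> the energy, and then
  \<open>2 * J + 1\<close> states in the sum. It is free of \<open>\<beta>\<close> because weights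
  never decrease along the paths.\<close>

lemma mixture_second_eigval_le:
  assumes "J \<ge> 1" "\<beta> \<ge> 0"
  shows "eigval 2 (kernel_mat J (mixture_kernel J \<beta>)) \<le> 1 - 1 / (4 * (real J + 1)\<^sup>2 * (2 * real J + 1))"
proof -
  interpret reversible_kernel J "weight J \<beta>" "mixture_kernel J \<beta>"
    using assms by (rule mixture_kernel_reversible)
  show ?thesis
  proof (rule second_eigval_kernel_le)
    show "int J \<in> state_space J" by (simp add: state_space_def)
  next
    fix f :: "int \<Rightarrow> real" assume fJ: "f (int J) = 0"
    define S where "S = sqrt (energy_form f)"
    have S: "S \<ge> 0" "S\<^sup>2 = energy_form f"
      by (simp_all add: S_def dirichlet_nonneg)
    \<comment> \<open>With the root of the weight included, \<open>step\<close> is a triangle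
      inequality: on a move that does not climb, the weight at \<open>x\<close> is at most that at
      \<open>y\<close>.\<close>
    define G where "G x = sqrt (weight J \<beta> x) * \<bar>f x\<bar>" for x
    have step: "G x \<le> G y + 2 * S"
      if "x \<in> state_space J" "y \<in> state_space J" "energy J y \<le> energy J x"
        "P_kernel J \<beta> x y = 1 / 2 \<or> P_kernel J \<beta> (psi J x) (psi J y) = 1 / 2" for x y
    proof -
      \<comment> \<open>One of the two averaged kernels makes the move with probability
        \<open>1 / 2\<close>. The resulting \<open>1 / 4\<close> becomes the factor 2 in
        \<open>2 * S\<close> after taking roots.\<close>
      have "mixture_kernel J \<beta> x y \<ge> 1 / 4"
        using that(4) P_kernel_nonneg [OF assms(2), of J x y] P_kernel_nonneg [OF assms(2), of J "psi J x" "psi J y"]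
        by (auto simp: mixture_kernel_def)
      then have "weight J \<beta> x * (1 / 4) * (f x - f y)\<^sup>2 \<le> weight J \<beta> x * mixture_kernel J \<beta> x y * (f x - f y)\<^sup>2"
        by (intro mult_right_mono mult_left_mono) (simp_all add: less_imp_le)
      also have "\<dots> \<le> energy_form f"
        using that by (intro edge_le_dirichlet)
      finally have "weight J \<beta> x * (f x - f y)\<^sup>2 \<le> (2 * S)\<^sup>2"
        using S(2) by (simp add: power_mult_distrib)
      then have "sqrt (weight J \<beta> x * (f x - f y)\<^sup>2) \<le> 2 * S"
        using S(1) by (intro real_le_lsqrt) auto
      then have "sqrt (weight J \<beta> x) * \<bar>f x - f y\<bar> \<le> 2 * S"
        by (simp add: real_sqrt_mult)
      moreover have "G x \<le> sqrt (weight J \<beta> x) * (\<bar>f x - f y\<bar> + \<bar>f y\<bar>)"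
        unfolding G_def by (intro mult_left_mono) (auto simp: less_imp_le)
      moreover have "sqrt (weight J \<beta> x) * \<bar>f y\<bar> \<le> G y"
        unfolding G_def using weight_mono [OF assms(2) that(3)] by (intro mult_right_mono) auto
      ultimately show ?thesis by (simp add: algebra_simps)
    qed
    have right: "G (int J - int k) \<le> 2 * real k * S" if "k \<le> J" for k
      using that
    proof (induction k)
      case 0
      then show ?case using fJ by (simp add: G_def)
    next
      case (Suc k)
      have "G (int J - int (Suc k)) \<le> G (int J - int k) + 2 * S"
      proof (rule step)
        show "energy J (int J - int k) \<le> energy J (int J - int (Suc k))"
          using Suc.prems by (auto simp: energy_def)
        then show "P_kernel J \<beta> (int J - int (Suc k)) (int J - int k) = 1 / 2 \<or>
            P_kernel J \<beta> (psi J (int J - int (Suc k))) (psi J (int J - int k)) = 1 / 2"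
          using Suc.prems by (intro disjI1 [OF P_kernel_downhill]) (auto simp: state_space_def)
      qed (use Suc.prems in \<open>auto simp: state_space_def\<close>)
      with Suc show ?case by (simp add: algebra_simps)
    qed
    have left: "G (int k - int J) \<le> 2 * (real k + 1) * S" if "k \<le> J" for k
      using that
    proof (induction k)
      case 0
      \<comment> \<open>\<open>psi\<close> takes \<open>- J\<close> to \<open>J - 1\<close> and
        fixes \<open>J\<close>, so this jump is the downhill move from \<open>J - 1\<close> to
        \<open>J\<close> in relabelled form. It accounts for the extra step in
        \<open>k + 1\<close>.\<close>
      have "G (- int J) \<le> G (int J) + 2 * S"
      proof (rule step)
        show "P_kernel J \<beta> (- int J) (int J) = 1 / 2 \<or> P_kernel J \<beta> (psi J (- int J)) (psi J (int J)) = 1 / 2"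
          using assms by (intro disjI2 [OF P_kernel_downhill]) (auto simp: state_space_def psi_def energy_def)
      qed (use assms in \<open>auto simp: state_space_def energy_def\<close>)
      then show ?case using fJ by (simp add: G_def)
    next
      case (Suc k)
      have "G (int (Suc k) - int J) \<le> G (int k - int J) + 2 * S"
      proof (rule step)
        show "energy J (int k - int J) \<le> energy J (int (Suc k) - int J)"
          using Suc.prems by (auto simp: energy_def)
        then show "P_kernel J \<beta> (int (Suc k) - int J) (int k - int J) = 1 / 2 \<or>
            P_kernel J \<beta> (psi J (int (Suc k) - int J)) (psi J (int k - int J)) = 1 / 2"
          using Suc.prems by (intro disjI1 [OF P_kernel_downhill]) (auto simp: state_space_def)
      qed (use Suc.prems in \<open>auto simp: state_space_def\<close>)
      with Suc show ?case by (simp add: algebra_simps)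
    qed
    have "weight J \<beta> x * (f x)\<^sup>2 \<le> 4 * (real J + 1)\<^sup>2 * energy_form f" if x: "x \<in> state_space J" for x
    proof -
      obtain k where k: "k \<le> J" "x = int J - int k \<or> x = int k - int J"
      proof (cases "x \<ge> 0")
        case True
        then show ?thesis using that [of "nat (int J - x)"] x by (auto simp: state_space_def)
      next
        case False
        then show ?thesis using that [of "nat (int J + x)"] x by (auto simp: state_space_def)
      qed
      have "2 * real k * S \<le> 2 * (real J + 1) * S" "2 * (real k + 1) * S \<le> 2 * (real J + 1) * S"
        using k(1) S(1) by (auto intro!: mult_right_mono)
      then have "G x \<le> 2 * (real J + 1) * S"
        using left [OF k(1)] right [OF k(1)] k(2) by auto
      moreover have "G x \<ge> 0"
        by (simp add: G_def less_imp_le)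
      ultimately have "(G x)\<^sup>2 \<le> (2 * (real J + 1) * S)\<^sup>2"
        by (rule power_mono)
      also have "(2 * (real J + 1) * S)\<^sup>2 = 4 * (real J + 1)\<^sup>2 * energy_form f"
        unfolding power_mult_distrib S(2) by simp
      finally show ?thesis
        by (simp add: G_def power_mult_distrib less_imp_le)
    qed
    then have "(\<Sum>x\<in>state_space J. weight J \<beta> x * (f x)\<^sup>2) \<le>
        real (card (state_space J)) * (4 * (real J + 1)\<^sup>2 * energy_form f)"
      by (intro sum_bounded_above) auto
    also have "real (card (state_space J)) = 2 * real J + 1"
      by (simp add: state_space_def)
    finally show "1 / (4 * (real J + 1)\<^sup>2 * (2 * real J + 1)) * (\<Sum>x\<in>state_space J. weight J \<beta> x * (f x)\<^sup>2) \<le> energy_form f"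
      by (simp add: pos_divide_le_eq mult_ac)
  qed
qed

text \<open>A path to \<open>J\<close> has at most \<open>2 * J\<close> edges, each costing
  \<open>S\<close> with \<open>S\<^sup>2\<close> twice the energy. This gives
  \<open>8 * (real J)\<^sup>2\<close> per state, and \<open>2 * J + 1\<close> states are
  summed.\<close>

lemma P_second_eigval_le:
  assumes "J \<ge> 2" "\<beta> \<ge> 0"
  shows "eigval 2 (kernel_mat J (P_kernel J \<beta>)) \<le> 1 - exp (- \<beta> * real J) / (8 * (real J)\<^sup>2 * (2 * real J + 1))"
proof -
  interpret reversible_kernel J "weight J \<beta>" "P_kernel J \<beta>"
    using assms by (intro P_kernel_reversible) auto
  show ?thesis
  proof (rule second_eigval_kernel_le)
    show "int J \<in> state_space J" by (simp add: state_space_def)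
  next
    fix f :: "int \<Rightarrow> real" assume fJ: "f (int J) = 0"
    define S where "S = sqrt (2 * energy_form f)"
    have S: "S \<ge> 0" "S\<^sup>2 = 2 * energy_form f"
      by (simp_all add: S_def dirichlet_nonneg)
    have step: "\<bar>f x - f (x + 1)\<bar> \<le> S" if "x \<in> state_space J" "x + 1 \<in> state_space J" for x
    proof -
      have "max (energy J x) (energy J (x + 1)) \<le> 0"
        using assms by (auto simp: energy_def)
      then have "1 / 2 \<le> weight J \<beta> x * P_kernel J \<beta> x (x + 1)"
        using that assms(2) by (subst P_kernel_conductance) (auto simp: mult_nonneg_nonpos)
      then have "1 / 2 * (f x - f (x + 1))\<^sup>2 \<le> weight J \<beta> x * P_kernel J \<beta> x (x + 1) * (f x - f (x + 1))\<^sup>2"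
        by (rule mult_right_mono) simp
      also have "\<dots> \<le> energy_form f"
        using that by (rule edge_le_dirichlet)
      finally have "\<bar>f x - f (x + 1)\<bar>\<^sup>2 \<le> S\<^sup>2"
        using S(2) by simp
      then show ?thesis using S(1) by (rule power2_le_imp_le)
    qed
    have f_le: "\<bar>f (int J - int k)\<bar> \<le> real k * S" if "k \<le> 2 * J" for k
      using that
    proof (induction k)
      case 0
      then show ?case using fJ by simp
    next
      case (Suc k)
      have "\<bar>f (int J - int (Suc k)) - f (int J - int (Suc k) + 1)\<bar> \<le> S"
        using Suc.prems by (intro step) (auto simp: state_space_def)
      also have "int J - int (Suc k) + 1 = int J - int k" by simp
      finally show ?case using Suc by (simp add: algebra_simps)
    qed
    have "weight J \<beta> x * (f x)\<^sup>2 \<le> exp (\<beta> * real J) * (8 * (real J)\<^sup>2 * energy_form f)"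
      if x: "x \<in> state_space J" for x
    proof (cases "x = int J")
      case True
      then show ?thesis using fJ dirichlet_nonneg by simp
    next
      case False
      have "\<bar>f x\<bar> \<le> real (nat (int J - x)) * S"
        using f_le [of "nat (int J - x)"] x by (auto simp: state_space_def)
      also have "\<dots> \<le> 2 * real J * S"
        using x S(1) by (intro mult_right_mono) (auto simp: state_space_def)
      finally have "\<bar>f x\<bar>\<^sup>2 \<le> (2 * real J * S)\<^sup>2"
        by (rule power_mono) simp
      then have "(f x)\<^sup>2 \<le> 8 * (real J)\<^sup>2 * energy_form f"
        using S(2) by (simp add: power_mult_distrib)
      \<comment> \<open>Only \<open>J\<close> itself is deeper than \<open>- real J\<close>, and
        \<open>f\<close> vanishes there; this is what keeps the exponent at \<open>J\<close> instead
        of \<open>J + 1\<close>.\<close>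
      moreover have "- energy J x \<le> real J"
        using x False by (auto simp: energy_def state_space_def)
      then have "weight J \<beta> x \<le> exp (\<beta> * real J)"
        using mult_left_mono [OF _ assms(2)] by (fastforce simp: weight_def)
      ultimately show ?thesis
        by (intro mult_mono) auto
    qed
    then have "(\<Sum>x\<in>state_space J. weight J \<beta> x * (f x)\<^sup>2) \<le>
        real (card (state_space J)) * (exp (\<beta> * real J) * (8 * (real J)\<^sup>2 * energy_form f))"
      by (intro sum_bounded_above) auto
    also have "real (card (state_space J)) = 2 * real J + 1"
      by (simp add: state_space_def)
    finally have "exp (- \<beta> * real J) / (8 * (real J)\<^sup>2 * (2 * real J + 1)) *
        (\<Sum>x\<in>state_space J. weight J \<beta> x * (f x)\<^sup>2) \<le>
        exp (- \<beta> * real J) / (8 * (real J)\<^sup>2 * (2 * real J + 1)) *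
        ((2 * real J + 1) * (exp (\<beta> * real J) * (8 * (real J)\<^sup>2 * energy_form f)))"
      by (rule mult_left_mono) simp
    also have "\<dots> = energy_form f"
      using assms by (simp add: exp_minus divide_simps)
    finally show "exp (- \<beta> * real J) / (8 * (real J)\<^sup>2 * (2 * real J + 1)) *
        (\<Sum>x\<in>state_space J. weight J \<beta> x * (f x)\<^sup>2) \<le> energy_form f" .
  qed
qed

text \<open>The cut between \<open>- 1\<close> and \<open>0\<close> has energy \<open>1 / 2\<close>,
  while the two ends \<open>- J\<close> and \<open>J\<close> alone give any shift of the indicator a
  squared norm of at least \<open>exp (\<beta> * real J) / 2\<close>.\<close>

lemma P_second_eigval_ge:
  assumes "J \<ge> 2" "\<beta> \<ge> 0"
  shows "1 - exp (- \<beta> * real J) \<le> eigval 2 (kernel_mat J (P_kernel J \<beta>))"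
proof -
  interpret reversible_kernel J "weight J \<beta>" "P_kernel J \<beta>"
    using assms by (intro P_kernel_reversible) auto
  define \<phi> :: "int \<Rightarrow> real" where "\<phi> x = (if x < 0 then 1 else 0)" for x
  have cond: "weight J \<beta> x * P_kernel J \<beta> x y * (\<phi> x - \<phi> y)\<^sup>2 =
      (if (x, y) = (- 1, 0) \<or> (x, y) = (0, - 1) then 1 / 2 else 0)"
    if xy: "x \<in> state_space J" "y \<in> state_space J" for x y
  proof (cases "(x, y) = (- 1, 0) \<or> (x, y) = (0, - 1)")
    case True
    \<comment> \<open>Here \<open>J \<ge> 2\<close> matters: for \<open>J = 1\<close> the state 0
      coincides with \<open>J - 1\<close> and has energy -1.\<close>
    have "energy J 0 = 0" "energy J (- 1) \<le> 0"
      using assms by (auto simp: energy_def)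
    then show ?thesis
      using True P_kernel_conductance [OF xy, of \<beta>] by (auto simp: \<phi>_def max_def)
  next
    case False
    show ?thesis
    proof (cases "\<phi> x = \<phi> y")
      case True
      then show ?thesis using False by auto
    next
      case False
      then have "x \<noteq> y" by auto
      moreover have "nn_walk J x y = 0"
        using False \<open>\<not> ((x, y) = (- 1, 0) \<or> (x, y) = (0, - 1))\<close>
        by (auto simp: nn_walk_def \<phi>_def split: if_splits)
      ultimately show ?thesis
        using \<open>\<not> ((x, y) = (- 1, 0) \<or> (x, y) = (0, - 1))\<close>
        by (simp add: P_kernel_def metropolis_def)
    qed
  qed
  define T where "T = {(- 1 :: int, 0 :: int), (0, - 1)}"
  have T: "state_space J \<times> state_space J \<inter> T = T"
    using assms by (auto simp: T_def state_space_def)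
  have "energy_form \<phi> = 1 / 2 * (\<Sum>q\<in>state_space J \<times> state_space J. if q \<in> T then 1 / 2 else 0)"
    unfolding dirichlet_def sum.cartesian_product
    by (intro arg_cong2 [of _ _ _ _ "(*)"] sum.cong refl) (auto simp: cond T_def split: if_splits)
  also have "\<dots> = 1 / 2 * (\<Sum>q\<in>T. 1 / 2)"
    by (subst sum.inter_restrict [symmetric]) (simp_all only: T finite_cartesian_product finite_state_space)
  also have "\<dots> = 1 / 2"
    by (simp add: T_def)
  finally have form: "energy_form \<phi> = 1 / 2" .
  show ?thesis
  proof (rule second_eigval_kernel_ge [of _ "- 1" 0 \<phi>])
    fix a :: real
    have ends: "weight J \<beta> (- int J) \<ge> exp (\<beta> * real J)" "weight J \<beta> (int J) \<ge> exp (\<beta> * real J)"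
      using assms by (auto simp: weight_def energy_def algebra_simps)
    \<comment> \<open>The minimum is attained at \<open>a = - 1 / 2\<close>, where the shift
      balances the two ends.\<close>
    have "1 / 2 \<le> (1 + a)\<^sup>2 + a\<^sup>2"
      using zero_le_power2 [of "2 * a + 1"] by (simp add: power2_eq_square algebra_simps)
    then have "1 / 2 * exp (\<beta> * real J) \<le> exp (\<beta> * real J) * (1 + a)\<^sup>2 + exp (\<beta> * real J) * a\<^sup>2"
      by (simp add: distrib_left [symmetric])
    also have "\<dots> \<le> weight J \<beta> (- int J) * (1 + a)\<^sup>2 + weight J \<beta> (int J) * a\<^sup>2"
      using ends by (intro add_mono mult_right_mono) auto
    also have "\<dots> = (\<Sum>x\<in>{- int J, int J}. weight J \<beta> x * (\<phi> x + a)\<^sup>2)"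
      using assms by (simp add: \<phi>_def)
    also have "\<dots> \<le> (\<Sum>x\<in>state_space J. weight J \<beta> x * (\<phi> x + a)\<^sup>2)"
      by (intro sum_mono2) (auto simp: state_space_def less_imp_le)
    finally show "energy_form \<phi> \<le> exp (- \<beta> * real J) * (\<Sum>x\<in>state_space J. weight J \<beta> x * (\<phi> x + a)\<^sup>2)"
      unfolding form by (simp add: exp_minus field_simps)
  qed (use assms in \<open>auto simp: state_space_def \<phi>_def\<close>)
qed

section \<open>Relaxation times and their exponential rates\<close>

lemma t_rel_bounds:
  assumes "0 < g" "eigval 2 A \<le> 1 - g" "1 - h \<le> eigval 2 A"
  shows "1 / h \<le> t_rel A" "t_rel A \<le> 1 / g"
  using assms by (auto simp: t_rel_def intro!: divide_left_mono mult_pos_pos)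

text \<open>The second limit is stated for \<open>J \<ge> 2\<close>: for \<open>J = 1\<close> the
  path from -1 through 0 to 1 never climbs, so the gap of \<open>P_mat\<close> stays bounded below
  and the rate is 0 instead of 1.\<close>

theorem proposition7p2:
  fixes J :: nat
  assumes "J \<ge> 1"
  shows "((\<lambda>\<beta>. 1 / \<beta> * ln (t_rel (half_mixture (P_mat J \<beta>) (Q_mat J)))) \<longlongrightarrow> 0) at_top \<and>
         (J \<ge> 2 \<longrightarrow> ((\<lambda>\<beta>. 1 / \<beta> * ln (t_rel (P_mat J \<beta>))) \<longlongrightarrow> real J) at_top)"
proof (intro conjI impI)
  have decay: "((\<lambda>\<beta>. 1 / \<beta> * c) \<longlongrightarrow> 0) at_top" for c :: real
    using tendsto_divide_0 [OF tendsto_const [of c] filterlim_at_top_imp_at_infinity [OF filterlim_ident]]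
    by simp
  define C where "C = 4 * (real J + 1)\<^sup>2 * (2 * real J + 1)"
  have C: "C > 0" by (simp add: C_def)
  have bounds: "1 / \<beta> * ln (1 / 2) \<le> 1 / \<beta> * ln (t_rel (half_mixture (P_mat J \<beta>) (Q_mat J)))"
    "1 / \<beta> * ln (t_rel (half_mixture (P_mat J \<beta>) (Q_mat J))) \<le> 1 / \<beta> * ln C" if "\<beta> > 0" for \<beta>
  proof -
    let ?t = "t_rel (half_mixture (P_mat J \<beta>) (Q_mat J))"
    \<comment> \<open>The lower bound is \<open>1 / h\<close> with \<open>h = 2\<close>, from the
      eigenvalue bound -1. Both bounds are positive constants, so dividing their logarithms by
      \<open>\<beta>\<close> sends them to 0.\<close>
    have "1 / 2 \<le> ?t" "?t \<le> 1 / (1 / C)"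
      unfolding half_mixture_eq [OF assms]
      using t_rel_bounds [of "1 / C" "kernel_mat J (mixture_kernel J \<beta>)" 2] C that
        mixture_second_eigval_le [OF assms, of \<beta>]
        reversible_kernel.second_eigval_kernel_ge_minus_one [OF mixture_kernel_reversible [OF assms, of \<beta>]]
      by (simp_all add: C_def)
    then have "ln (1 / 2) \<le> ln ?t" "ln ?t \<le> ln C"
      by (subst ln_le_cancel_iff; use C in simp)+
    then show "1 / \<beta> * ln (1 / 2) \<le> 1 / \<beta> * ln ?t" "1 / \<beta> * ln ?t \<le> 1 / \<beta> * ln C"
      using that by (simp_all only: mult_left_mono divide_nonneg_pos zero_le_one)
  qed
  show "((\<lambda>\<beta>. 1 / \<beta> * ln (t_rel (half_mixture (P_mat J \<beta>) (Q_mat J)))) \<longlongrightarrow> 0) at_top"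
    by (rule tendsto_sandwich [OF _ _ decay decay];
        rule eventually_mono [OF eventually_gt_at_top [of 0]], erule bounds)
  assume J2: "J \<ge> 2"
  define D where "D = 8 * (real J)\<^sup>2 * (2 * real J + 1)"
  have D: "D > 0" using J2 by (simp add: D_def)
  have bounds: "real J \<le> 1 / \<beta> * ln (t_rel (P_mat J \<beta>))"
    "1 / \<beta> * ln (t_rel (P_mat J \<beta>)) \<le> real J + 1 / \<beta> * ln D" if "\<beta> > 0" for \<beta>
  proof -
    let ?t = "t_rel (P_mat J \<beta>)"
    \<comment> \<open>The lower bound on the relaxation time gives the rate \<open>J\<close>
      exactly; the polynomial factor \<open>D\<close> costs only \<open>ln D / \<beta>\<close> in
      the upper one.\<close>
    have t: "1 / exp (- \<beta> * real J) \<le> ?t" "?t \<le> 1 / (exp (- \<beta> * real J) / D)"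
      unfolding P_mat_eq
      using t_rel_bounds [of "exp (- \<beta> * real J) / D" "kernel_mat J (P_kernel J \<beta>)" "exp (- \<beta> * real J)"]
        D that P_second_eigval_le [OF J2, of \<beta>] P_second_eigval_ge [OF J2, of \<beta>]
      by (simp_all add: D_def)
    have "exp (\<beta> * real J) \<le> ?t" "?t \<le> exp (\<beta> * real J) * D"
      using t by (simp_all add: exp_minus field_simps)
    moreover from this have "?t > 0"
      using exp_gt_zero less_le_trans by blast
    ultimately have "\<beta> * real J \<le> ln ?t" "ln ?t \<le> ln (exp (\<beta> * real J) * D)"
      using D by (simp_all add: ln_ge_iff)
    moreover have "ln (exp (\<beta> * real J) * D) = \<beta> * real J + ln D"
      using D by (simp add: ln_mult)
    ultimately show "real J \<le> 1 / \<beta> * ln ?t" "1 / \<beta> * ln ?t \<le> real J + 1 / \<beta> * ln D"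
      using that by (simp_all add: field_simps)
  qed
  have lim: "((\<lambda>\<beta>. real J + 1 / \<beta> * ln D) \<longlongrightarrow> real J) at_top"
    using tendsto_add [OF tendsto_const decay] by simp
  show "((\<lambda>\<beta>. 1 / \<beta> * ln (t_rel (P_mat J \<beta>))) \<longlongrightarrow> real J) at_top"
    by (rule tendsto_sandwich [OF _ _ tendsto_const lim];
        rule eventually_mono [OF eventually_gt_at_top [of 0]], erule bounds)
qed

end
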